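(* Let $\mu>0$, $L_{\rm c}>0$, $b_1>0$, $b_2>0$, $b_3>0$, let $\omega\subset\mathbb{R}^2$ be a bounded domain with Lipschitz boundary, and let $\overline{R}_0:\omega\to \mathrm{SO}(3)$ be a microrotation field with first order partial derivatives $\partial_{x_1}\overline{R}_0,\partial_{x_2}\overline{R}_0$. Put $$\mathcal{K}^{\rm plate}_{\overline{R}_0}:=\big(\mathrm{axl}(\overline{R}_0^T\partial_{x_1}\overline{R}_0)\,\big|\,\mathrm{axl}(\overline{R}_0^T\partial_{x_2}\overline{R}_0)\,\big|\,0\big)\in\mathbb{R}^{3\times 3}.$$ Then the homogenized curvature energy for the flat Cosserat-shell model, defined (pointwise) by $$\widetilde{W}^{\rm hom, plate}_{\rm curv}(\mathcal{K}^{\rm plate}_{\overline{R}_0}):=\inf_{A\in\mathfrak{so}(3)}\widetilde{W}_{\rm curv}\Big(\mathrm{axl}(\overline{R}_0^T\partial_{x_1}\overline{R}_0)\,\big|\,\mathrm{axl}(\overline{R}_0^T\partial_{x_2}\overline{R}_0)\,\big|\,\mathrm{axl}(A)\Big),$$ is given by $$\widetilde{W}^{\rm hom, plate}_{\rm curv}(\mathcal{K}^{\rm plate}_{\overline{R}_0})=\mu L_{\rm c}^2\Big(b_1\big\|\mathrm{sym}[\mathcal{K}^{\rm plate}_{\overline{R}_0}]^{\parallel}\big\|^2+b_2\big\|\mathrm{skew}[\mathcal{K}^{\rm plate}_{\overline{R}_0}]^{\parallel}\big\|^2+\frac{b_1b_3}{b_1+b_3}\big[\mathrm{tr}([\mathcal{K}^{\rm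 plate}_{\overline{R}_0}]^{\parallel})\big]^2+\frac{2\,b_1b_2}{b_1+b_2}\big\|[\mathcal{K}^{\rm plate}_{\overline{R}_0}]^{\perp}\big\|^2\Big),$$ with the orthogonal decomposition in the tangential plane and in the normal direction $$\mathcal{K}^{\rm plate}_{\overline{R}_0}=[\mathcal{K}^{\rm plate}_{\overline{R}_0}]^{\parallel}+[\mathcal{K}^{\rm plate}_{\overline{R}_0}]^{\perp},\qquad [\mathcal{K}^{\rm plate}_{\overline{R}_0}]^{\parallel}:=(\mathbb{1}_3-e_3\otimes e_3)\,\mathcal{K}^{\rm plate}_{\overline{R}_0},\qquad [\mathcal{K}^{\rm plate}_{\overline{R}_0}]^{\perp}:=(e_3\otimes e_3)\,\mathcal{K}^{\rm plate}_{\overline{R}_0}.$$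
   Context: $\mathfrak{so}(3)$ is the space of skew-symmetric real $3\times3$ matrices; for $A\in\mathfrak{so}(3)$, $\mathrm{axl}(A)\in\mathbb{R}^3$ is the axial vector, i.e. $A v=\mathrm{axl}(A)\times v$ for all $v\in\mathbb{R}^3$ (so $\mathrm{axl}:\mathfrak{so}(3)\to\mathbb{R}^3$ is a linear bijection; note $\overline{R}_0^T\partial_{x_i}\overline{R}_0\in\mathfrak{so}(3)$). $(z_1|z_2|z_3)$ is the matrix with columns $z_1,z_2,z_3$. $\mathrm{sym}X=\frac12(X+X^T)$, $\mathrm{skew}X=\frac12(X-X^T)$, $\|X\|^2=\mathrm{tr}(XX^T)$ (Frobenius norm), $\mathbb{1}_3$ is the identity matrix, $(\xi\otimes\eta)_{ij}=\xi_i\eta_j$, and $e_3=(0,0,1)^T$. The three-dimensional isotropic Cosserat curvature energy is, for $\Gamma\in\mathbb{R}^{3\times3}$ (the wryness tensor), $$\widetilde{W}_{\rm curv}(\Gamma)=\mu L_{\rm c}^2\big(b_1\|\mathrm{sym}\,\Gamma\|^2+b_2\|\mathrm{skew}\,\Gamma\|^2+b_3[\mathrm{tr}(\Gamma)]^2\big).$$ All energies are evaluated pointwise in $\omega$, wherever the derivatives of $\overline{R}_0$ exist. *)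

theory Defs
  imports "HOL-Analysis.Analysis"
begin

unbundle cross3_syntax

section \<open>Matrices\<close>

text \<open>The Euclidean norm of the type \<open>real^3^3\<close> is the Frobenius norm.\<close>

lemma norm_matrix_frobenius:
  fixes X :: "real^'n^'m"
  shows "(norm X)\<^sup>2 = trace (X ** transpose X)"
  by (simp add: power2_norm_eq_inner inner_vec_def trace_def matrix_matrix_mult_def transpose_def)

definition sym_part :: "real^'n^'n \<Rightarrow> real^'n^'n" where
  "sym_part X = (1/2) *\<^sub>R (X + transpose X)"

definition skew_part :: "real^'n^'n \<Rightarrow> real^'n^'n" where
  "skew_part X = (1/2) *\<^sub>R (X - transpose X)"

definition tensor :: "real^'m \<Rightarrow> real^'n \<Rightarrow> real^'n^'m" where
  "tensor \<xi> \<eta> = (\<chi> i j. \<xi> $ i * \<eta> $ j)"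

definition e3 :: "real^3" where
  "e3 = axis 3 1"

text \<open>The library's \<open>vector [z1, z2, z3]\<close> has the \<open>zi\<close> as rows.\<close>

definition cols3 :: "real^3 \<Rightarrow> real^3 \<Rightarrow> real^3 \<Rightarrow> real^3^3" where
  "cols3 z1 z2 z3 = transpose (vector [z1, z2, z3])"

lemma column_cols3 [simp]:
  "column 1 (cols3 z1 z2 z3) = z1"
  "column 2 (cols3 z1 z2 z3) = z2"
  "column 3 (cols3 z1 z2 z3) = z3"
  by (simp_all add: cols3_def column_def transpose_def vec_eq_iff)

definition SO3 :: "(real^3^3) set" where
  "SO3 = {Q. rotation_matrix Q}"

definition so3 :: "(real^3^3) set" where
  "so3 = {A. transpose A = - A}"

definition axl :: "real^3^3 \<Rightarrow> real^3" where
  "axl A = (THE a. \<forall>v. A *v v = a \<times> v)"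

lemma axl_unique:
  assumes "\<And>v. A *v v = a \<times> v"
  shows "axl A = a"
  unfolding axl_def
proof (rule the_equality)
  fix b assume b: "\<forall>v. A *v v = b \<times> v"
  have "a \<times> axis 1 1 = b \<times> axis 1 1" "a \<times> axis 2 1 = b \<times> axis 2 1"
    by (simp_all only: assms [symmetric] b [rule_format, symmetric])
  then show "b = a"
    by (simp add: cross3_def axis_def vec_eq_iff forall_3)
qed (simp only: assms simp_thms)

lemma axl_mult:
  assumes "A \<in> so3"
  shows "A *v v = axl A \<times> v"
proof -
  let ?a = "vector [A$3$2, A$1$3, A$2$1] :: real^3"
  have a: "transpose A = - A"
    using assms by (simp only: so3_def mem_Collect_eq)
  have neg: "A$j$i = - (A$i$j)" for i j
    using arg_cong[OF a, of "\<lambda>M. M$i$j"] unfolding transpose_def by simp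
  have s: "A$1$1 = 0" "A$2$2 = 0" "A$3$3 = 0"
      "A$1$2 = - (A$2$1)" "A$2$3 = - (A$3$2)" "A$3$1 = - (A$1$3)"
    by (rule neg | use neg[of 1 1] neg[of 2 2] neg[of 3 3] in linarith)+
  have *: "A *v w = ?a \<times> w" for w
    by (simp add: matrix_vector_mult_def cross3_def vec_eq_iff forall_3 sum_3 s)
  show ?thesis
    unfolding axl_unique[OF *] by (rule *)
qed


section \<open>Lipschitz domains and partial derivatives in the plane\<close>

text \<open>Near each boundary point, in suitable orthonormal coordinates \<open>(s, t)\<close> centred there,
  \<open>\<Omega>\<close> is the part of a rectangle below the graph of a Lipschitz function.\<close>

definition lipschitz_boundary :: "(real^2) set \<Rightarrow> bool" where
  "lipschitz_boundary \<Omega> \<longleftrightarrow>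
    (\<forall>p\<in>frontier \<Omega>. \<exists>u v r h L. \<exists>g :: real \<Rightarrow> real.
       norm u = 1 \<and> norm v = 1 \<and> orthogonal u v \<and> r > 0 \<and> h > 0 \<and>
       L-lipschitz_on {-r<..<r} g \<and> (\<forall>s\<in>{-r<..<r}. \<bar>g s\<bar> < h) \<and>
       (\<forall>s\<in>{-r<..<r}. \<forall>t\<in>{-h<..<h}. p + s *\<^sub>R u + t *\<^sub>R v \<in> \<Omega> \<longleftrightarrow> t < g s))"

definition bounded_lipschitz_domain :: "(real^2) set \<Rightarrow> bool" where
  "bounded_lipschitz_domain \<Omega> \<longleftrightarrow>
    open \<Omega> \<and> connected \<Omega> \<and> \<Omega> \<noteq> {} \<and> bounded \<Omega> \<and> lipschitz_boundary \<Omega>"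

text \<open>On an open domain, values outside the domain do not affect these one-variable derivatives.\<close>

definition partial_differentiable_at :: "2 \<Rightarrow> (real^2 \<Rightarrow> real^3^3) \<Rightarrow> real^2 \<Rightarrow> bool" where
  "partial_differentiable_at i R x \<longleftrightarrow> (\<lambda>t. R (x + t *\<^sub>R axis i 1)) differentiable (at 0)"

definition partial_deriv :: "2 \<Rightarrow> (real^2 \<Rightarrow> real^3^3) \<Rightarrow> real^2 \<Rightarrow> real^3^3" where
  "partial_deriv i R x = vector_derivative (\<lambda>t. R (x + t *\<^sub>R axis i 1)) (at 0)"


section \<open>Curvature energies\<close>

definition W_curv :: "real \<Rightarrow> real \<Rightarrow> real \<Rightarrow> real \<Rightarrow> real \<Rightarrow> real^3^3 \<Rightarrow> real" where
  "W_curv \<mu> Lc b1 b2 b3 \<Gamma> =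
     \<mu> * Lc\<^sup>2 * (b1 * (norm (sym_part \<Gamma>))\<^sup>2 + b2 * (norm (skew_part \<Gamma>))\<^sup>2 + b3 * (trace \<Gamma>)\<^sup>2)"

definition K_plate :: "(real^2 \<Rightarrow> real^3^3) \<Rightarrow> real^2 \<Rightarrow> real^3^3" where
  "K_plate R x =
     cols3 (axl (transpose (R x) ** partial_deriv 1 R x))
           (axl (transpose (R x) ** partial_deriv 2 R x)) 0"

text \<open>The homogenized energy as a function of the tensor \<open>K\<close>, whose first two columns are kept
  while the third one is relaxed. For nonnegative coefficients the infimum is over a set that is
  bounded below.\<close>

definition W_hom_plate :: "real \<Rightarrow> real \<Rightarrow> real \<Rightarrow> real \<Rightarrow> real \<Rightarrow> real^3^3 \<Rightarrow> real" where
  "W_hom_plate \<mu> Lc b1 b2 b3 K =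
     (INF A\<in>so3. W_curv \<mu> Lc b1 b2 b3 (cols3 (column 1 K) (column 2 K) (axl A)))"

lemma W_hom_plate_K_plate:
  "W_hom_plate \<mu> Lc b1 b2 b3 (K_plate R x) =
     (INF A\<in>so3. W_curv \<mu> Lc b1 b2 b3
        (cols3 (axl (transpose (R x) ** partial_deriv 1 R x))
               (axl (transpose (R x) ** partial_deriv 2 R x)) (axl A)))"
  by (simp add: W_hom_plate_def K_plate_def)

lemma W_curv_bdd_below:
  assumes "\<mu> \<ge> 0" "b1 \<ge> 0" "b2 \<ge> 0" "b3 \<ge> 0"
  shows "bdd_below (W_curv \<mu> Lc b1 b2 b3 ` S)"
  by (rule bdd_belowI2[where m = 0]) (use assms in \<open>simp add: W_curv_def\<close>)

definition tangential :: "real^3^3 \<Rightarrow> real^3^3" where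
  "tangential K = (mat 1 - tensor e3 e3) ** K"

definition normal_part :: "real^3^3 \<Rightarrow> real^3^3" where
  "normal_part K = tensor e3 e3 ** K"

unbundle no cross3_syntax

end

theory Submission
  imports Defs
begin

text \<open>The energy minimised is a quadratic polynomial in the free third column \<open>z\<close>. In the
  three components of \<open>z\<close> it decouples. The diagonal entry \<open>z$3\<close> meets only the trace of the first
  two columns, through \<open>b1\<close> and \<open>b3\<close>. Each off-diagonal entry \<open>z$1\<close>, \<open>z$2\<close> meets only the
  transposed entry in the third row, through the symmetric part (weight \<open>b1\<close>) and the skew part
  (weight \<open>b2\<close>). Completing the square in each component (\<open>complete_square_trace\<close> and
  \<open>complete_square_sym_skew\<close>) leaves as remainders half the harmonic mean of \<open>b1, b3\<close> as the
  coefficient of the squared trace of the tangential part, and the harmonic mean of \<open>b1, b2\<close> as the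
  coefficient of the squared normal part. The tangential \<open>2\<times>2\<close> block is unaffected by \<open>z\<close>.
  This is \<open>W_curv_cols3_eq\<close>: the energy is the claimed value plus nonnegative squares that
  vanish simultaneously at one \<open>z\<close>. Since \<open>axl\<close> maps \<open>so3\<close> onto all of \<open>real^3\<close>, that \<open>z\<close> is
  attained by an admissible \<open>A\<close>, so the infimum is a minimum with the claimed value.\<close>

unbundle cross3_syntax

text \<open>The linear map \<open>v \<mapsto> a \<times> v\<close> has a skew-symmetric matrix, because
  \<open>(a \<times> v) \<bullet> w = - (v \<bullet> (a \<times> w))\<close>. Minimising over \<open>so3\<close> is therefore the same as minimising over
  all third columns.\<close>

lemma axl_image_so3: "axl ` so3 = UNIV"
proof -
  have "a \<in> axl ` so3" for a
  proof
    let ?A = "vector [vector [0, - a$3, a$2], vector [a$3, 0, - a$1], vector [- a$2, a$1, 0]]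
      :: real^3^3"
    have "?A *v v = a \<times> v" for v
      by (simp add: matrix_vector_mult_def cross3_def vec_eq_iff forall_3 sum_3)
    then show "a = axl ?A"
      by (rule axl_unique [symmetric])
    show "?A \<in> so3"
      by (simp add: so3_def transpose_def vec_eq_iff forall_3)
  qed
  then show ?thesis by blast
qed

unbundle no cross3_syntax

lemma norm_matrix_sum_squares:
  fixes X :: "real^'n^'m"
  shows "(norm X)\<^sup>2 = (\<Sum>i\<in>UNIV. \<Sum>j\<in>UNIV. (X$i$j)\<^sup>2)"
  unfolding power2_norm_eq_inner inner_vec_def by (simp add: power2_eq_square)

lemma norm_sym_part_3:
  fixes X :: "real^3^3"
  shows "(norm (sym_part X))\<^sup>2 = (X$1$1)\<^sup>2 + (X$2$2)\<^sup>2 + (X$3$3)\<^sup>2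
    + (X$1$2 + X$2$1)\<^sup>2 / 2 + (X$1$3 + X$3$1)\<^sup>2 / 2 + (X$2$3 + X$3$2)\<^sup>2 / 2"
proof -
  have nth: "sym_part X $ i $ j = (X$i$j + X$j$i) / 2" for i j
    by (simp add: sym_part_def transpose_def field_simps)
  show ?thesis
    unfolding norm_matrix_sum_squares nth sum_3
    by (simp add: power_divide add.commute[of "X$2$1"] add.commute[of "X$3$1"]
        add.commute[of "X$3$2"])
qed

lemma norm_skew_part_3:
  fixes X :: "real^3^3"
  shows "(norm (skew_part X))\<^sup>2 =
    (X$1$2 - X$2$1)\<^sup>2 / 2 + (X$1$3 - X$3$1)\<^sup>2 / 2 + (X$2$3 - X$3$2)\<^sup>2 / 2"
proof -
  have nth: "skew_part X $ i $ j = (X$i$j - X$j$i) / 2" for i j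
    by (simp add: skew_part_def transpose_def field_simps)
  show ?thesis
    unfolding norm_matrix_sum_squares nth sum_3
    by (simp add: power_divide power2_commute[of "X$2$1"] power2_commute[of "X$3$1"]
        power2_commute[of "X$3$2"])
qed

lemma cols3_nth:
  "cols3 u v w $ i $ 1 = u$i" "cols3 u v w $ i $ 2 = v$i" "cols3 u v w $ i $ 3 = w$i"
  by (simp_all add: cols3_def transpose_def)

lemma tangential_nth: "tangential K $ i $ j = (if i = 3 then 0 else K$i$j)"
  using exhaust_3[of i]
  by (auto simp: tangential_def tensor_def e3_def axis_def mat_def
        matrix_matrix_mult_def sum_3)

lemma normal_part_nth: "normal_part K $ i $ j = (if i = 3 then K$i$j else 0)"
  using exhaust_3[of i]
  by (auto simp: normal_part_def tensor_def e3_def axis_def matrix_matrix_mult_def sum_3)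

text \<open>The projections keep complementary sets of rows.\<close>

lemma tangential_plus_normal_part: "tangential K + normal_part K = K"
  by (simp add: vec_eq_iff tangential_nth normal_part_nth)

lemma orthogonal_tangential_normal_part: "orthogonal (tangential K) (normal_part K)"
  by (auto simp: orthogonal_def inner_vec_def tangential_nth normal_part_nth intro!: sum.neutral)

text \<open>The left-hand side is what two mutually transposed off-diagonal entries \<open>s\<close> and \<open>z\<close>
  contribute to the symmetric and skew terms of the energy.\<close>

lemma complete_square_sym_skew:
  fixes a b s z :: real
  assumes "a + b \<noteq> 0"
  shows "a * (s + z)\<^sup>2 / 2 + b * (s - z)\<^sup>2 / 2
    = 2 * a * b / (a + b) * s\<^sup>2 + (a + b) / 2 * (z - (b - a) / (a + b) * s)\<^sup>2"
proof -
  define c where "c = (b - a) / (a + b)"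
  have c: "(a + b) * c = b - a"
    using assms by (simp add: c_def)
  have k: "2 * a * b / (a + b) = (a + b) / 2 - (b - a) * c / 2"
    using assms by (simp add: c_def field_simps)
  have "(a + b) / 2 * (z - c * s)\<^sup>2
      = (a + b) / 2 * z\<^sup>2 - ((a + b) * c) * s * z + ((a + b) * c) * c / 2 * s\<^sup>2"
    by (simp add: power2_eq_square field_simps)
  then show ?thesis
    unfolding k c_def[symmetric] c by (simp add: power2_eq_square field_simps)
qed

lemma complete_square_trace:
  fixes a b t z :: real
  assumes "a + b \<noteq> 0"
  shows "a * z\<^sup>2 + b * (t + z)\<^sup>2 = a * b / (a + b) * t\<^sup>2 + (a + b) * (z + b / (a + b) * t)\<^sup>2"
proof -
  define c where "c = b / (a + b)"
  have c: "(a + b) * c = b"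
    using assms by (simp add: c_def)
  have k: "a * b / (a + b) = b - b * c"
    using assms by (simp add: c_def field_simps)
  have "(a + b) * (z + c * t)\<^sup>2
      = (a + b) * z\<^sup>2 + 2 * ((a + b) * c) * t * z + ((a + b) * c) * c * t\<^sup>2"
    by (simp add: power2_eq_square field_simps)
  then show ?thesis
    unfolding k c_def[symmetric] c by (simp add: power2_eq_square field_simps)
qed

definition W_relaxed :: "real \<Rightarrow> real \<Rightarrow> real \<Rightarrow> real \<Rightarrow> real \<Rightarrow> real^3^3 \<Rightarrow> real" where
  "W_relaxed \<mu> Lc b1 b2 b3 K = \<mu> * Lc\<^sup>2 *
     (b1 * (norm (sym_part (tangential K)))\<^sup>2
      + b2 * (norm (skew_part (tangential K)))\<^sup>2
      + b1 * b3 / (b1 + b3) * (trace (tangential K))\<^sup>2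
      + 2 * b1 * b2 / (b1 + b2) * (norm (normal_part K))\<^sup>2)"

text \<open>The third column of \<open>K\<close> must be zero here: it would contribute to the norms of the tangential
  and the normal part, although it is replaced by \<open>z\<close> on the left-hand side.\<close>

lemma W_curv_cols3_eq:
  fixes u v z :: "real^3"
  assumes "b1 + b2 \<noteq> 0" and "b1 + b3 \<noteq> 0"
  shows "W_curv \<mu> Lc b1 b2 b3 (cols3 u v z) = W_relaxed \<mu> Lc b1 b2 b3 (cols3 u v 0)
    + \<mu> * Lc\<^sup>2 *
      ((b1 + b2) / 2 * ((z$1 - (b2 - b1) / (b1 + b2) * u$3)\<^sup>2
                        + (z$2 - (b2 - b1) / (b1 + b2) * v$3)\<^sup>2)
       + (b1 + b3) * (z$3 + b3 / (b1 + b3) * (u$1 + v$2))\<^sup>2)"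
    (is "_ = _ + _ * ?squares")
proof -
  let ?K = "cols3 u v 0"
  have sym: "(norm (sym_part (cols3 u v z)))\<^sup>2 = (u$1)\<^sup>2 + (v$2)\<^sup>2 + (z$3)\<^sup>2
      + (u$2 + v$1)\<^sup>2 / 2 + (u$3 + z$1)\<^sup>2 / 2 + (v$3 + z$2)\<^sup>2 / 2"
    by (simp add: norm_sym_part_3 cols3_nth add.commute)
  have skew: "(norm (skew_part (cols3 u v z)))\<^sup>2
      = (u$2 - v$1)\<^sup>2 / 2 + (u$3 - z$1)\<^sup>2 / 2 + (v$3 - z$2)\<^sup>2 / 2"
    by (simp add: norm_skew_part_3 cols3_nth power2_commute)
  have tr: "trace (cols3 u v z) = (u$1 + v$2) + z$3"
    by (simp add: trace_def sum_3 cols3_nth)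
  have sym_tan: "(norm (sym_part (tangential ?K)))\<^sup>2
      = (u$1)\<^sup>2 + (v$2)\<^sup>2 + (u$2 + v$1)\<^sup>2 / 2"
    by (simp add: norm_sym_part_3 cols3_nth tangential_nth add.commute)
  have skew_tan: "(norm (skew_part (tangential ?K)))\<^sup>2 = (u$2 - v$1)\<^sup>2 / 2"
    by (simp add: norm_skew_part_3 cols3_nth tangential_nth power2_commute)
  have tr_tan: "trace (tangential ?K) = u$1 + v$2"
    by (simp add: trace_def sum_3 cols3_nth tangential_nth)
  have normal: "(norm (normal_part ?K))\<^sup>2 = (u$3)\<^sup>2 + (v$3)\<^sup>2"
    unfolding norm_matrix_sum_squares
    by (simp add: sum_3 cols3_nth normal_part_nth)
  have "b1 * (norm (sym_part (cols3 u v z)))\<^sup>2 + b2 * (norm (skew_part (cols3 u v z)))\<^sup>2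
        + b3 * (trace (cols3 u v z))\<^sup>2
      = b1 * ((u$1)\<^sup>2 + (v$2)\<^sup>2 + (u$2 + v$1)\<^sup>2 / 2) + b2 * ((u$2 - v$1)\<^sup>2 / 2)
        + (b1 * (u$3 + z$1)\<^sup>2 / 2 + b2 * (u$3 - z$1)\<^sup>2 / 2)
        + (b1 * (v$3 + z$2)\<^sup>2 / 2 + b2 * (v$3 - z$2)\<^sup>2 / 2)
        + (b1 * (z$3)\<^sup>2 + b3 * ((u$1 + v$2) + z$3)\<^sup>2)"
    unfolding sym skew tr by (simp add: distrib_left)
  also have "\<dots> = b1 * (norm (sym_part (tangential ?K)))\<^sup>2
        + b2 * (norm (skew_part (tangential ?K)))\<^sup>2
        + b1 * b3 / (b1 + b3) * (trace (tangential ?K))\<^sup>2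
        + 2 * b1 * b2 / (b1 + b2) * (norm (normal_part ?K))\<^sup>2 + ?squares"
    unfolding complete_square_sym_skew[OF assms(1)] complete_square_trace[OF assms(2)]
      sym_tan skew_tan tr_tan normal
    by (simp only: distrib_left add_ac)
  finally show ?thesis
    unfolding W_curv_def W_relaxed_def by (simp only: distrib_left)
qed

theorem theorem3p1:
  fixes \<mu> Lc b1 b2 b3 :: real
    and \<omega> :: "(real^2) set"
    and R :: "real^2 \<Rightarrow> real^3^3"
    and x :: "real^2"
  assumes "\<mu> > 0" and "Lc > 0" and "b1 > 0" and "b2 > 0" and "b3 > 0"
    and "bounded_lipschitz_domain \<omega>"
    and "\<And>y. y \<in> \<omega> \<Longrightarrow> R y \<in> SO3"
    and "x \<in> \<omega>"
    and "partial_differentiable_at 1 R x" and "partial_differentiable_at 2 R x"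
  defines "K \<equiv> K_plate R x"
  shows "W_hom_plate \<mu> Lc b1 b2 b3 K =
           \<mu> * Lc\<^sup>2 *
             (b1 * (norm (sym_part (tangential K)))\<^sup>2
              + b2 * (norm (skew_part (tangential K)))\<^sup>2
              + b1 * b3 / (b1 + b3) * (trace (tangential K))\<^sup>2
              + 2 * b1 * b2 / (b1 + b2) * (norm (normal_part K))\<^sup>2)
         \<and> K = tangential K + normal_part K
         \<and> orthogonal (tangential K) (normal_part K)"
proof -
  define u v where "u = column 1 K" and "v = column 2 K"
  have K: "K = cols3 u v 0"
    by (simp add: u_def v_def K_def K_plate_def)
  let ?E = "\<lambda>z. W_curv \<mu> Lc b1 b2 b3 (cols3 u v z)"
  have ne: "b1 + b2 \<noteq> 0" "b1 + b3 \<noteq> 0"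
    using assms(3-5) by simp_all
  note E = W_curv_cols3_eq[OF ne, of \<mu> Lc u v, folded K]
  (* The common zero of the three squares. *)
  define z0 :: "real^3" where "z0 = vector
    [(b2 - b1) / (b1 + b2) * u$3, (b2 - b1) / (b1 + b2) * v$3, - (b3 / (b1 + b3) * (u$1 + v$2))]"
  have min: "?E z0 = W_relaxed \<mu> Lc b1 b2 b3 K"
    by (simp add: E z0_def)
  have le: "W_relaxed \<mu> Lc b1 b2 b3 K \<le> ?E z" for z
    unfolding E using assms(1,3-5) by simp
  have "W_hom_plate \<mu> Lc b1 b2 b3 K = Inf (?E ` axl ` so3)"
    by (simp add: W_hom_plate_def u_def v_def image_image)
  also have "\<dots> = Inf (range ?E)"
    by (simp only: axl_image_so3)
  also have "\<dots> = W_relaxed \<mu> Lc b1 b2 b3 K"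
    by (rule cInf_eq_minimum) (use min le in \<open>auto simp: image_iff intro: exI[of _ z0]\<close>)
  finally show ?thesis
    by (simp add: W_relaxed_def tangential_plus_normal_part orthogonal_tangential_normal_part)
qed

end
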